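(* For any tree $T$, $\rho^{0}(T)\leq L_2(T)\leq 2\rho^{0}(T)$. Moreover, $\rho^{0}(T)= L_2(T)$ if and only if $T\in \mathcal{T}$, where $\mathcal{T}$ is the set of trees $T$ whose vertex set can be partitioned into two disjoint subsets $S_0$ and $R_0$ (with $R_0$ possibly empty) such that: (i) $T[S_0]=aK_2$ for some positive integer $a$, and each of these copies of $K_2$ has at least one vertex with degree $1$ in $T$; (ii) for each $r\in R_0$, $|N(r)\cap S_0|=1$.
   Context: All graphs (in particular trees) are finite, undirected, simple and nontrivial (at least two vertices). $N(v)$ is the open neighbourhood of $v$ and $N[v]=\{v\}\cup N(v)$ the closed neighbourhood. $T[S]$ is the subgraph induced by $S$, and $aK_2$ is the vertex-disjoint union of $a$ copies of $K_2$. An open packing of $G$ is a set $S\subseteq V(G)$ with $|N(v)\cap S|\le 1$ for every vertex $v$ of $G$; the open packing number $\rho^0(G)$ is the maximum cardinality of an open packing. A set $B\subseteq V(G)$ is a $2$-limited packing if $|N[v]\cap B|\le 2$ for every vertex $v$ of $G$; $L_2(G)$ is the maximum cardinality of a $2$-limited packing in $G$. *)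

theory Defs
  imports "Graph_Theory.Graph_Theory"
begin

text \<open>
  Finite simple graphs are the symmetric digraphs \<open>graph\<close> of the AFP entry
  Graph_Theory: every undirected edge is a pair of opposite arcs.  In this representation
  the walk \<open>u, v, u\<close> counts as a directed cycle, so \<open>Digraph_Component.tree\<close> excludes every
  edge and cannot be used for undirected trees.  The closed walks of length at least 3 whose
  vertices are distinct are exactly the cycles of the undirected graph.
\<close>

definition nontrivial_tree :: "('a, 'b) pre_digraph \<Rightarrow> bool" where
  "nontrivial_tree G \<longleftrightarrow>
     graph G \<and> 2 \<le> card (verts G) \<and> Digraph_Component.connected G \<and>
     \<not> (\<exists>p. pre_digraph.cycle G p \<and> 3 \<le> length p)"

definition nbhd :: "('a, 'b) pre_digraph \<Rightarrow> 'a \<Rightarrow> 'a set" where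
  "nbhd G v = {u. v \<rightarrow>\<^bsub>G\<^esub> u}"

definition closed_nbhd :: "('a, 'b) pre_digraph \<Rightarrow> 'a \<Rightarrow> 'a set" where
  "closed_nbhd G v = {v} \<union> nbhd G v"

definition degree :: "('a, 'b) pre_digraph \<Rightarrow> 'a \<Rightarrow> nat" where
  "degree G v = card (nbhd G v)"

definition open_packing :: "('a, 'b) pre_digraph \<Rightarrow> 'a set \<Rightarrow> bool" where
  "open_packing G S \<longleftrightarrow> S \<subseteq> verts G \<and> (\<forall>v \<in> verts G. card (nbhd G v \<inter> S) \<le> 1)"

definition open_packing_number :: "('a, 'b) pre_digraph \<Rightarrow> nat" where
  "open_packing_number G = Max {card S | S. open_packing G S}"

definition limited_packing2 :: "('a, 'b) pre_digraph \<Rightarrow> 'a set \<Rightarrow> bool" where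
  "limited_packing2 G B \<longleftrightarrow> B \<subseteq> verts G \<and> (\<forall>v \<in> verts G. card (closed_nbhd G v \<inter> B) \<le> 2)"

definition L2 :: "('a, 'b) pre_digraph \<Rightarrow> nat" where
  "L2 G = Max {card B | B. limited_packing2 G B}"

text \<open>The graph $aK_2$; its \<open>i\<close>-th copy of $K_2$ has the vertices \<open>(i, False)\<close> and \<open>(i, True)\<close>.\<close>

definition copies_K2 :: "nat \<Rightarrow> (nat \<times> bool) pair_pre_digraph" where
  "copies_K2 a = \<lparr> pverts = {..<a} \<times> UNIV,
     parcs = {((i, b), (j, c)) | i b j c. i < a \<and> j = i \<and> c \<noteq> b} \<rparr>"

text \<open>
  Since $T[S_0]$ is isomorphic to $aK_2$, the copies of $K_2$ it consists of are precisely its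
  subgraphs \<open>H\<close> that are complete graphs on two vertices.
\<close>

definition family_T :: "('a, 'b) pre_digraph set" where
  "family_T = {T. nontrivial_tree T \<and>
     (\<exists>S0 R0. S0 \<union> R0 = verts T \<and> S0 \<inter> R0 = {} \<and>
        (\<exists>a > 0. digraph_iso (T \<restriction> S0) (with_proj (copies_K2 a))) \<and>
        (\<forall>H. subgraph H (T \<restriction> S0) \<and> K\<^bsub>2\<^esub> H \<longrightarrow> (\<exists>v \<in> verts H. degree T v = 1)) \<and>
        (\<forall>r \<in> R0. card (nbhd T r \<inter> S0) = 1))}"

end

theory Submission
  imports Defs
begin

text \<open>
  An open packing is a 2-limited packing.  Conversely, eliminating leaves one at a time, the elements
  of a 2-limited packing of a tree can be 2-coloured so that no open neighbourhood contains two of the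
  same colour; the larger colour class is an open packing of at least half the size.

  If $\rho^0(T) = L_2(T)$, a maximum open packing \<open>S\<close> is also a maximum 2-limited packing, and \<open>S\<close> itself
  serves as $S_0$: a vertex without neighbour in \<open>S\<close>, or a copy of $K_2$ in $T[S]$ without a leaf, would
  allow a larger 2-limited packing.
\<close>

section \<open>Cycles as vertex walks, and leaves of induced forests\<close>

lemma nontrivial_tree_graph: "nontrivial_tree G \<Longrightarrow> graph G"
  by (simp add: nontrivial_tree_def)

text \<open>Cycles are defined on lists of arcs, while the combinatorial arguments build lists of
  vertices; this is the bridge from the latter to the former.\<close>

lemma (in wf_digraph) vwalk_imp_awalk:
  assumes "vwalk p G"
  shows "\<exists>es. awalk (hd p) es (last p) \<and> awalk_verts (hd p) es = p"
  using assms
proof (induction p rule: vwalk_induct)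
  case (Base u)
  then show ?case by (intro exI[of _ "[]"]) (simp add: awalk_Nil_iff)
next
  case (Cons u v ps)
  then obtain es where es: "awalk v es (last (v # ps))" "awalk_verts v es = v # ps" by auto
  from Cons obtain e where "e \<in> arcs G" "tail G e = u" "head G e = v"
    by (auto simp: arcs_ends_conv)
  with es show ?case
    by (intro exI[of _ "e # es"]) (auto simp: awalk_Cons_iff)
qed

lemma nontrivial_tree_no_cycle:
  assumes "nontrivial_tree G" "vwalk xs G" "distinct xs" "3 \<le> length xs"
  shows "\<not> last xs \<rightarrow>\<^bsub>G\<^esub> hd xs"
proof
  assume adj: "last xs \<rightarrow>\<^bsub>G\<^esub> hd xs"
  interpret graph G using assms(1) by (rule nontrivial_tree_graph)
  have "vwalk (last xs # xs) G"
    using assms(2) adj by (intro vwalk_consI) (auto simp: adj_in_verts)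
  from vwalk_imp_awalk[OF this] assms(2)
  obtain es where es: "awalk (last xs) es (last xs)" "awalk_verts (last xs) es = last xs # xs"
    by (auto simp: vwalk_def)
  \<comment> \<open>A walk visits one vertex more than it has arcs, and the start
    \<open>last xs\<close> was prepended, so the closed walk has exactly \<open>length xs\<close>
    arcs.\<close>
  have "length es = length xs"
    using es(2) by (metis length_Cons length_awalk_verts Suc_eq_plus1 nat.inject)
  then have "cycle es \<and> 3 \<le> length es"
    using es assms(3,4) by (auto simp: cycle_def)
  with assms(1) show False by (auto simp: nontrivial_tree_def)
qed

text \<open>The first vertex of a longest path inside \<open>W\<close> qualifies: a neighbour in
  \<open>W\<close> other than the second vertex would either prolong the path or close a
  cycle.\<close>

lemma nontrivial_tree_leaf:
  assumes T: "nontrivial_tree G" and W: "W \<subseteq> verts G" "W \<noteq> {}"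
  shows "\<exists>v\<in>W. \<exists>p. nbhd G v \<inter> W \<subseteq> {p}"
proof (rule ccontr)
  assume no_leaf: "\<not> ?thesis"
  interpret graph G using T by (rule nontrivial_tree_graph)
  have finW: "finite W" using W(1) finite_verts by (rule finite_subset)
  define P where "P xs \<longleftrightarrow> vpath xs G \<and> set xs \<subseteq> W" for xs
  from W obtain w where "w \<in> W" "w \<in> verts G" by auto
  then have "P [w]" by (auto simp: P_def vpath_def vwalk_def)
  moreover have "length xs < Suc (card W)" if "P xs" for xs
    using that card_mono[OF finW, of "set xs"] by (auto simp: P_def vpath_def distinct_card)
  ultimately obtain xs where xs: "P xs" and longest: "\<And>ys. P ys \<Longrightarrow> length ys \<le> length xs"
    using ex_has_greatest_nat[of P "[w]" length] by blast
  then obtain x ys where xs_eq: "xs = x # ys" by (cases xs) (auto simp: P_def vpath_def vwalk_def)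
  have "x \<in> W" using xs by (simp add: xs_eq P_def)
  \<comment> \<open>For empty \<open>ys\<close> the value \<open>hd ys\<close> is unspecified, which
    is harmless: the assumption holds for every candidate \<open>p\<close>, and \<open>y\<close> is
    shown to lie in \<open>ys\<close> anyway.\<close>
  then have "\<not> nbhd G x \<inter> W \<subseteq> {hd ys}" using no_leaf by blast
  then obtain y where y: "x \<rightarrow>\<^bsub>G\<^esub> y" "y \<in> W" "y \<noteq> hd ys" by (auto simp: nbhd_def)
  have yx: "y \<rightarrow>\<^bsub>G\<^esub> x" using y(1) by (rule graph_symmetric)
  have "y \<in> set xs"
  proof (rule ccontr)
    assume "y \<notin> set xs"
    then have "P (y # xs)"
      using xs yx y(2) by (auto simp: P_def vpath_def xs_eq adj_in_verts intro!: vwalk_consI)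
    from longest[OF this] show False by simp
  qed
  moreover have "y \<noteq> x" using y(1) adj_not_same by blast
  ultimately obtain as bs where ys: "ys = as @ y # bs" by (auto simp: xs_eq in_set_conv_decomp)
  \<comment> \<open>At least one vertex lies between \<open>x\<close> and \<open>y\<close> on the
    path, so the cycle closed by the arc from \<open>y\<close> to \<open>x\<close> has length at
    least 3.\<close>
  with y(3) have "as \<noteq> []" by auto
  have "vwalk (x # as @ [y]) G"
    using xs set_vwalk_arcs_append1[of "x # as @ [y]" bs]
    by (auto simp: P_def vpath_def vwalk_def xs_eq ys)
  moreover have "distinct (x # as @ [y])" using xs by (auto simp: P_def vpath_def xs_eq ys)
  moreover have "3 \<le> length (x # as @ [y])" using \<open>as \<noteq> []\<close> by (cases as) auto
  ultimately show False
    using nontrivial_tree_no_cycle[OF T, of "x # as @ [y]"] yx by simp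
qed

section \<open>Two-colouring a 2-limited packing\<close>

lemma finite_nbhd: "graph G \<Longrightarrow> finite (nbhd G v)"
  by (rule finite_subset[of _ "verts G"])
     (auto simp: nbhd_def graph_def digraph_def fin_digraph.finite_verts wf_digraph.adj_in_verts fin_digraph_def)

lemma card_le_2I: "A \<subseteq> {a, b} \<Longrightarrow> card A \<le> 2"
  using card_mono[of "{a, b}" A] card_insert_le_m1[of 2 "{b}" a] by simp

lemma card_le_1D:
  assumes "finite A" "card A \<le> 1"
  obtains q where "A \<subseteq> {q}"
proof (cases "A = {}")
  case False
  then have "card A = 1" using assms card_gt_0_iff[of A] by linarith
  then show ?thesis using that by (auto simp: card_1_singleton_iff)
qed (use that in auto)

text \<open>Delete a leaf of the forest, colour the rest, and restore the leaf: it competes only with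
  the other element of \<open>B\<close> in the neighbourhood of its unique neighbour.\<close>

lemma nontrivial_tree_colouring:
  assumes T: "nontrivial_tree G" and B: "\<And>v. v \<in> verts G \<Longrightarrow> card (nbhd G v \<inter> B) \<le> 2"
    and "W \<subseteq> verts G"
  shows "\<exists>c :: 'a \<Rightarrow> bool. \<forall>v\<in>W. inj_on c (nbhd G v \<inter> B \<inter> W)"
proof -
  interpret graph G using T by (rule nontrivial_tree_graph)
  have "finite W" using assms(3) finite_verts by (rule finite_subset)
  then show ?thesis using assms(3)
  proof (induction W rule: finite_psubset_induct)
    case (psubset W)
    show ?case
    proof (cases "W = {}")
      case False
      with nontrivial_tree_leaf[OF T psubset.prems] obtain l p
        where l: "l \<in> W" "nbhd G l \<inter> W \<subseteq> {p}" by blast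
      obtain c :: "'a \<Rightarrow> bool" where c: "\<forall>v\<in>W - {l}. inj_on c (nbhd G v \<inter> B \<inter> (W - {l}))"
        using psubset.IH[of "W - {l}"] psubset.prems l(1) by blast
      \<comment> \<open>\<open>q\<close> is the possible rival of \<open>l\<close> around
        \<open>p\<close>. The premises leave \<open>q\<close> arbitrary when \<open>l\<close> is
        outside \<open>B\<close> or \<open>p\<close> is not a neighbour of \<open>l\<close> in
        \<open>W\<close>, since then no clash can arise.\<close>
      obtain q where q: "l \<in> B \<Longrightarrow> p \<in> nbhd G l \<inter> W \<Longrightarrow> nbhd G p \<inter> B \<subseteq> {l, q}"
      proof (cases "l \<in> B \<and> p \<in> nbhd G l \<inter> W")
        case True
        then have "l \<in> nbhd G p \<inter> B" by (auto simp: nbhd_def graph_symmetric)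
        moreover have "card (nbhd G p \<inter> B) \<le> 2" using B True psubset.prems by auto
        ultimately have "card (nbhd G p \<inter> B - {l}) \<le> Suc 0"
          using finite_nbhd[OF graph_axioms, of p] by simp
        then obtain q where "nbhd G p \<inter> B - {l} \<subseteq> {q}"
          using card_le_1D[of "nbhd G p \<inter> B - {l}"] finite_nbhd[OF graph_axioms, of p] by auto
        then show ?thesis using that by blast
      qed (use that in blast)
      have "inj_on (c(l := \<not> c q)) (nbhd G v \<inter> B \<inter> W)" if v: "v \<in> W" for v
      proof (cases "v = l")
        case True
        then show ?thesis using l(2) by (auto simp: inj_on_def)
      next
        case False
        \<comment> \<open>Among the vertices of \<open>W\<close> only \<open>p\<close> can see
          \<open>l\<close>, so giving \<open>l\<close> the colour opposite to \<open>q\<close>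
          settles every neighbourhood.\<close>
        have "b = q" if "l \<in> nbhd G v \<inter> B" "b \<in> nbhd G v \<inter> B" "b \<noteq> l" for b
        proof -
          have "v \<in> nbhd G l" using that(1) by (auto simp: nbhd_def graph_symmetric)
          then have "v = p" using l(2) v by auto
          then show ?thesis using q that \<open>v \<in> nbhd G l\<close> v by auto
        qed
        moreover have "inj_on c (nbhd G v \<inter> B \<inter> (W - {l}))" using c v False by auto
        ultimately show ?thesis by (auto simp: inj_on_def)
      qed
      then show ?thesis by blast
    qed auto
  qed
qed

lemma limited_packing2_card_le:
  assumes T: "nontrivial_tree G" and B: "limited_packing2 G B"
  shows "\<exists>S. open_packing G S \<and> card B \<le> 2 * card S"
proof -
  interpret graph G using T by (rule nontrivial_tree_graph)
  have "card (nbhd G v \<inter> B) \<le> 2" if "v \<in> verts G" for v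
  proof -
    have "card (nbhd G v \<inter> B) \<le> card (closed_nbhd G v \<inter> B)"
      by (intro card_mono) (auto simp: closed_nbhd_def finite_nbhd[OF graph_axioms])
    then show ?thesis using B that by (force simp: limited_packing2_def)
  qed
  then obtain c :: "'a \<Rightarrow> bool" where c: "\<And>v. v \<in> verts G \<Longrightarrow> inj_on c (nbhd G v \<inter> B \<inter> verts G)"
    using nontrivial_tree_colouring[OF T, of B "verts G"] by blast
  have B_verts: "B \<subseteq> verts G" using B by (simp add: limited_packing2_def)
  have packing: "open_packing G {b \<in> B. c b = i}" for i
    unfolding open_packing_def
  proof (intro conjI ballI)
    fix v assume "v \<in> verts G"
    from c[OF this] B_verts have "\<forall>a\<in>nbhd G v \<inter> {b \<in> B. c b = i}. \<forall>b\<in>nbhd G v \<inter> {b \<in> B. c b = i}. a = b"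
      by (auto simp: inj_on_def subset_iff)
    then show "card (nbhd G v \<inter> {b \<in> B. c b = i}) \<le> 1"
      by (simp add: card_le_Suc0_iff_eq finite_nbhd[OF graph_axioms])
  qed (use B_verts in auto)
  have "card B \<le> card {b \<in> B. c b = True} + card {b \<in> B. c b = False}"
    by (rule order_trans[OF _ card_Un_le], rule card_mono)
       (use finite_subset[OF B_verts finite_verts] in auto)
  then have "card B \<le> 2 * card {b \<in> B. c b = True} \<or> card B \<le> 2 * card {b \<in> B. c b = False}"
    by linarith
  then show ?thesis using packing by blast
qed

section \<open>The two packing numbers as attained maxima\<close>

lemma open_packing_imp_limited_packing2:
  assumes "graph G" "open_packing G S"
  shows "limited_packing2 G S"
  unfolding limited_packing2_def
proof (intro conjI ballI)
  fix v assume "v \<in> verts G"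
  then have "card (nbhd G v \<inter> S) \<le> 1" using assms(2) by (simp add: open_packing_def)
  then obtain q where "nbhd G v \<inter> S \<subseteq> {q}"
    using card_le_1D[of "nbhd G v \<inter> S"] finite_nbhd[OF assms(1)] by auto
  then show "card (closed_nbhd G v \<inter> S) \<le> 2"
    by (intro card_le_2I[of _ v q]) (auto simp: closed_nbhd_def)
qed (use assms(2) in \<open>simp add: open_packing_def\<close>)

lemma finite_card_subsets:
  assumes "finite V" "\<And>S. P S \<Longrightarrow> S \<subseteq> V"
  shows "finite {card S | S. P S}"
  by (rule finite_subset[of _ "card ` Pow V"]) (use assms in auto)

lemma open_packing_number_ge:
  assumes "graph G" "open_packing G S"
  shows "card S \<le> open_packing_number G"
proof -
  interpret graph G by fact
  show ?thesis unfolding open_packing_number_def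
    by (intro Max_ge finite_card_subsets[of "verts G"]) (use assms in \<open>auto simp: open_packing_def\<close>)
qed

lemma open_packing_number_attained:
  assumes "graph G"
  obtains S where "open_packing G S" "card S = open_packing_number G"
proof -
  interpret graph G by fact
  have "open_packing_number G \<in> {card S | S. open_packing G S}" unfolding open_packing_number_def
    \<comment> \<open>The empty set is a packing, so the maximum is taken over a nonempty
      set.\<close>
    by (intro Max_in finite_card_subsets[of "verts G"]) (auto simp: open_packing_def intro!: exI[of _ "{}"])
  then show ?thesis using that by auto
qed

lemma L2_ge:
  assumes "graph G" "limited_packing2 G B"
  shows "card B \<le> L2 G"
proof -
  interpret graph G by fact
  show ?thesis unfolding L2_def
    by (intro Max_ge finite_card_subsets[of "verts G"]) (use assms in \<open>auto simp: limited_packing2_def\<close>)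
qed

lemma L2_attained:
  assumes "graph G"
  obtains B where "limited_packing2 G B" "card B = L2 G"
proof -
  interpret graph G by fact
  have "L2 G \<in> {card B | B. limited_packing2 G B}" unfolding L2_def
    by (intro Max_in finite_card_subsets[of "verts G"]) (auto simp: limited_packing2_def intro!: exI[of _ "{}"])
  then show ?thesis using that by auto
qed

section \<open>Perfect matchings: induced copies of $K_2$ and the bound they give on 2-limited
  packings\<close>

lemma nontrivial_tree_nbhd_nonempty:
  assumes "nontrivial_tree G" "v \<in> verts G"
  shows "nbhd G v \<noteq> {}"
proof -
  interpret graph G using assms(1) by (rule nontrivial_tree_graph)
  have "\<not> card (verts G) \<le> Suc 0" using assms(1) by (simp add: nontrivial_tree_def)
  then obtain w where w: "w \<in> verts G" "w \<noteq> v"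
    using assms(2) by (auto simp: card_le_Suc0_iff_eq)
  \<comment> \<open>Connectedness is reachability in the symmetric closure; the first arc of a walk
    to \<open>w\<close> already gives a neighbour, because \<open>G\<close> is symmetric
    itself.\<close>
  have "v \<rightarrow>\<^sup>*\<^bsub>with_proj (mk_symmetric G)\<^esub> w"
    using assms w(1) by (simp add: nontrivial_tree_def connected_def strongly_connected_def)
  then obtain u where "v \<rightarrow>\<^bsub>with_proj (mk_symmetric G)\<^esub> u"
    using w(2) by (cases rule: pre_digraph.converse_reachable_cases) auto
  then show ?thesis
    using adj_mk_symmetric_eq[OF sym_arcs] by (auto simp: nbhd_def)
qed

text \<open>Turns the isomorphism of condition (i) into the counting form used by the packing
  arguments: adjacency is transported both ways, and in \<open>copies_K2 a\<close> the only
  neighbour of \<open>(i, b)\<close> is \<open>(i, \<not> b)\<close>.\<close>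

lemma (in graph) induced_copies_K2_nbhd:
  assumes "digraph_iso (G \<restriction> S) (with_proj (copies_K2 a))" "v \<in> S"
  shows "card (nbhd G v \<inter> S) = 1"
proof -
  obtain f where f: "pre_digraph.digraph_isomorphism (G \<restriction> S) f"
    and eq: "with_proj (copies_K2 a) = app_iso f (G \<restriction> S)"
    using assms(1) by (auto simp: digraph_iso_def)
  let ?\<phi> = "iso_verts f"
  have inj: "inj_on ?\<phi> S"
    using f by (simp add: pre_digraph.digraph_isomorphism_def)
  \<comment> \<open>The records are equal as a whole, so their tail and head functions agree
    everywhere and not merely on arcs.\<close>
  have tail_f: "iso_tail f = fst" and head_f: "iso_head f = snd"
    and image: "?\<phi> ` S = {..<a} \<times> UNIV"
    and parcs: "parcs (copies_K2 a) = iso_arcs f ` arcs (G \<restriction> S)"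
    using arg_cong[OF eq, of tail] arg_cong[OF eq, of head] arg_cong[OF eq, of verts] arg_cong[OF eq, of arcs]
    by (auto simp: app_iso_def copies_K2_def)
  have ends: "?\<phi> (tail G e) = fst (iso_arcs f e)" "?\<phi> (head G e) = snd (iso_arcs f e)"
    if "e \<in> arcs (G \<restriction> S)" for e
    using f that by (auto simp: pre_digraph.digraph_isomorphism_def tail_f head_f simp del: induce_subgraph_arcs)
  have adj: "x \<rightarrow>\<^bsub>G\<^esub> y \<longleftrightarrow> (?\<phi> x, ?\<phi> y) \<in> parcs (copies_K2 a)" if "x \<in> S" "y \<in> S" for x y
  proof
    assume "x \<rightarrow>\<^bsub>G\<^esub> y"
    then obtain e where "e \<in> arcs G" "tail G e = x" "head G e = y" by (rule reachableE)
    then have e: "e \<in> arcs (G \<restriction> S)" "tail G e = x" "head G e = y" using that by auto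
    with ends[OF e(1)] have "iso_arcs f e = (?\<phi> x, ?\<phi> y)" by (simp add: prod_eq_iff)
    then show "(?\<phi> x, ?\<phi> y) \<in> parcs (copies_K2 a)" using e(1) parcs by force
  next
    assume "(?\<phi> x, ?\<phi> y) \<in> parcs (copies_K2 a)"
    then obtain e where e: "e \<in> arcs (G \<restriction> S)" "iso_arcs f e = (?\<phi> x, ?\<phi> y)"
      unfolding parcs by force
    then have "tail G e = x" "head G e = y"
      using ends[OF e(1)] inj that by (auto dest: inj_onD)
    then show "x \<rightarrow>\<^bsub>G\<^esub> y" using e(1) by (auto simp: arcs_ends_conv)
  qed
  have "?\<phi> v \<in> {..<a} \<times> UNIV" using image assms(2) by blast
  then obtain i b where v: "?\<phi> v = (i, b)" "i < a" by auto
  then have "(i, \<not> b) \<in> ?\<phi> ` S" by (simp add: image)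
  then obtain u where u: "u \<in> S" "?\<phi> u = (i, \<not> b)" by force
  have "nbhd G v \<inter> S = {u}"
  proof (intro equalityI subsetI)
    fix w assume w: "w \<in> nbhd G v \<inter> S"
    then have "?\<phi> w = ?\<phi> u" using adj[OF assms(2), of w] u v by (auto simp: nbhd_def copies_K2_def)
    then show "w \<in> {u}" using inj_onD[OF inj] u(1) w by blast
  next
    fix w assume "w \<in> {u}"
    then show "w \<in> nbhd G v \<inter> S" using adj[OF assms(2), of u] u v by (simp add: nbhd_def copies_K2_def)
  qed
  then show ?thesis by simp
qed

lemma obtain_partner:
  assumes "\<forall>v\<in>V. card (nbhd G v \<inter> S) = 1"
  obtains m where "\<forall>v\<in>V. nbhd G v \<inter> S = {m v}"
proof -
  have "\<forall>v\<in>V. \<exists>u. nbhd G v \<inter> S = {u}" using assms by (auto simp: card_1_singleton_iff)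
  from bchoice[OF this] obtain m where "\<forall>v\<in>V. nbhd G v \<inter> S = {m v}" by blast
  then show ?thesis by (rule that)
qed

text \<open>Adjacency is symmetric, so a unique neighbour inside \<open>S\<close> is a mutual
  relation: \<open>m\<close> is the involution of a perfect matching of the induced
  subgraph.\<close>

lemma (in graph) partner_involution:
  assumes "\<forall>v\<in>S. nbhd G v \<inter> S = {m v}" "v \<in> S"
  shows "m v \<in> S" "m (m v) = v" "m v \<noteq> v" "v \<rightarrow>\<^bsub>G\<^esub> m v"
proof -
  show S: "m v \<in> S" and adj: "v \<rightarrow>\<^bsub>G\<^esub> m v" using assms by (auto simp: nbhd_def set_eq_iff)
  show "m v \<noteq> v" using adj adj_not_same by fastforce
  have "v \<in> nbhd G (m v) \<inter> S" using adj assms(2) by (auto simp: nbhd_def graph_symmetric)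
  then show "m (m v) = v" using assms(1) S by auto
qed

text \<open>Converse of \<open>induced_copies_K2_nbhd\<close>: the matching edges are numbered by
  \<open>h\<close>, and the two ends of each edge are told apart by a Boolean.\<close>

lemma (in graph) induced_copies_K2I:
  assumes S: "S \<subseteq> verts G" "S \<noteq> {}" "\<forall>v\<in>S. card (nbhd G v \<inter> S) = 1"
  shows "\<exists>a>0. digraph_iso (G \<restriction> S) (with_proj (copies_K2 a))"
proof -
  obtain m where m: "\<forall>v\<in>S. nbhd G v \<inter> S = {m v}"
    by (rule obtain_partner[OF S(3)])
  note m' = partner_involution[OF m]
  define E where "E v = {v, m v}" for v
  define a where "a = card (E ` S)"
  have "finite S" using S(1) finite_verts by (rule finite_subset)
  then have "a > 0" using S(2) by (simp add: a_def card_gt_0_iff)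
  obtain h where h: "bij_betw h (E ` S) {..<a}"
    using ex_bij_betw_finite_nat[of "E ` S"] \<open>finite S\<close> by (auto simp: a_def lessThan_atLeast0)
  \<comment> \<open>One end of each edge is singled out. The choice depends on the edge only, so
    exactly one of \<open>v\<close> and \<open>m v\<close> receives \<open>True\<close> in
    \<open>\<phi>\<close>.\<close>
  define rep where "rep p = (SOME x. x \<in> p)" for p :: "'a set"
  have rep: "rep (E v) \<in> E v" for v unfolding rep_def E_def by (rule someI[of _ v]) simp
  have E_m: "E (m v) = E v" if "v \<in> S" for v using m'[OF that] by (auto simp: E_def)
  define \<phi> where "\<phi> v = (h (E v), v = rep (E v))" for v
  have \<phi>_m: "\<phi> (m v) = (fst (\<phi> v), \<not> snd (\<phi> v))" if "v \<in> S" for v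
    using rep[of v] m'[OF that] by (auto simp: \<phi>_def E_m[OF that]) (auto simp: E_def)
  have inj: "inj_on \<phi> S"
  proof (rule inj_onI)
    fix u v assume uv: "u \<in> S" "v \<in> S" "\<phi> u = \<phi> v"
    then have "E u = E v" using h by (auto simp: \<phi>_def bij_betw_def dest: inj_onD)
    then have "u = v \<or> u = m v" by (auto simp: E_def)
    then show "u = v" using \<phi>_m[OF uv(2)] uv(3) by (auto simp: prod_eq_iff)
  qed
  have image: "\<phi> ` S = {..<a} \<times> UNIV"
  proof
    show "\<phi> ` S \<subseteq> {..<a} \<times> UNIV" using h by (auto simp: \<phi>_def bij_betw_def)
    show "{..<a} \<times> UNIV \<subseteq> \<phi> ` S"
    proof
      fix z :: "nat \<times> bool" assume z: "z \<in> {..<a} \<times> UNIV"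
      then have "fst z \<in> h ` E ` S" using h by (auto simp: bij_betw_def)
      then obtain v where v: "v \<in> S" "fst z = fst (\<phi> v)" by (auto simp: \<phi>_def)
      then have "z = \<phi> v \<or> z = \<phi> (m v)" using \<phi>_m[OF v(1)] by (auto simp: prod_eq_iff)
      then show "z \<in> \<phi> ` S" using v(1) m'(1) by blast
    qed
  qed
  let ?f = "\<lparr>iso_verts = \<phi>, iso_arcs = (\<lambda>e. (\<phi> (tail G e), \<phi> (head G e))),
    iso_head = snd, iso_tail = fst\<rparr>"
  have head_arc: "head G e = m (tail G e)" if "e \<in> arcs (G \<restriction> S)" for e
  proof -
    have "head G e \<in> nbhd G (tail G e) \<inter> S" using that by (auto simp: nbhd_def arcs_ends_conv)
    then show ?thesis using m that by auto
  qed
  \<comment> \<open>An arc is determined by its ends, as there are no parallel arcs, and the ends by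
    their images under \<open>\<phi>\<close>.\<close>
  have "inj_on (iso_arcs ?f) (arcs (G \<restriction> S))"
    using inj by (auto simp: inj_on_def arc_to_ends_def intro!: no_multi_arcs)
  moreover have "wf_digraph (G \<restriction> S)"
    by (rule wellformed_induce_subgraph)
  ultimately have iso: "pre_digraph.digraph_isomorphism (G \<restriction> S) ?f"
    using inj by (auto simp: pre_digraph.digraph_isomorphism_def)
  have "parcs (copies_K2 a) = iso_arcs ?f ` arcs (G \<restriction> S)"
  proof
    show "iso_arcs ?f ` arcs (G \<restriction> S) \<subseteq> parcs (copies_K2 a)"
    proof
      fix z assume "z \<in> iso_arcs ?f ` arcs (G \<restriction> S)"
      then obtain e where e: "e \<in> arcs (G \<restriction> S)" "z = iso_arcs ?f e" by blast
      from e(2) have z: "z = (\<phi> (tail G e), \<phi> (m (tail G e)))"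
        by (simp add: head_arc[OF e(1)])
      have t: "tail G e \<in> S" using e(1) by auto
      then have "\<phi> (tail G e) \<in> {..<a} \<times> UNIV" using image by blast
      then show "z \<in> parcs (copies_K2 a)"
        using z \<phi>_m[OF t] by (cases "\<phi> (tail G e)") (auto simp: copies_K2_def)
    qed
    show "parcs (copies_K2 a) \<subseteq> iso_arcs ?f ` arcs (G \<restriction> S)"
    proof
      fix z assume "z \<in> parcs (copies_K2 a)"
      then obtain i b where z: "z = ((i, b), (i, \<not> b))" "i < a" by (auto simp: copies_K2_def)
      then have "(i, b) \<in> \<phi> ` S" by (simp add: image)
      then obtain v where v: "v \<in> S" "\<phi> v = (i, b)" by force
      then obtain e where "e \<in> arcs G" "tail G e = v" "head G e = m v"
        using m'(4)[OF v(1)] by (blast elim: reachableE)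
      then show "z \<in> iso_arcs ?f ` arcs (G \<restriction> S)"
        using v z m'(1)[OF v(1)] \<phi>_m[OF v(1)] by (auto intro!: image_eqI[of _ _ e])
    qed
  qed
  then have "with_proj (copies_K2 a) = app_iso ?f (G \<restriction> S)"
    using image by (simp add: with_proj_def app_iso_def) (simp add: copies_K2_def)
  then show ?thesis using iso \<open>a > 0\<close> by (auto simp: digraph_iso_def)
qed

text \<open>In every copy of $K_2$ choose an end whose partner is a leaf: the closed neighbourhoods of the
  chosen vertices cover the graph, and each contains at most two elements of \<open>B\<close>.\<close>

lemma (in graph) limited_packing2_card_le_perfect:
  assumes S: "S \<subseteq> verts G" "\<forall>v\<in>verts G. card (nbhd G v \<inter> S) = 1"
    and leaf: "\<And>x y. x \<in> S \<Longrightarrow> y \<in> S \<Longrightarrow> x \<rightarrow>\<^bsub>G\<^esub> y \<Longrightarrow> degree G x = 1 \<or> degree G y = 1"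
    and B: "limited_packing2 G B"
  shows "card B \<le> card S"
proof -
  obtain m where m: "\<forall>v\<in>verts G. nbhd G v \<inter> S = {m v}"
    by (rule obtain_partner[OF S(2)])
  have m_S: "\<forall>v\<in>S. nbhd G v \<inter> S = {m v}" using m S(1) by blast
  note m' = partner_involution[OF m_S]
  define E where "E v = {v, m v}" for v
  have "finite S" using S(1) finite_verts by (rule finite_subset)
  have E_m: "E (m v) = E v" if "v \<in> S" for v using m'[OF that] by (auto simp: E_def)
  have "\<exists>y. y \<in> S \<and> (\<exists>x\<in>S. p = {x, y} \<and> nbhd G x = {y})" if p: "p \<in> E ` S" for p
  proof -
    have sole: "nbhd G x = {m x}" if "x \<in> S" "degree G x = 1" for x
      using that m'(4)[OF that(1)] by (auto simp: degree_def card_1_singleton_iff nbhd_def set_eq_iff)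
    obtain v where v: "v \<in> S" "p = {v, m v}" using p unfolding E_def by blast
    from leaf[OF v(1) m'(1)[OF v(1)] m'(4)[OF v(1)]] show ?thesis
    proof
      assume "degree G v = 1"
      then show ?thesis using v sole m'(1) by blast
    next
      assume "degree G (m v) = 1"
      then have "nbhd G (m v) = {v}" using sole[of "m v"] m'[OF v(1)] by simp
      then show ?thesis using v m'(1)[OF v(1)] by (intro exI[of _ v] conjI bexI[of _ "m v"]) auto
    qed
  qed
  then have "\<forall>p\<in>E ` S. \<exists>y. y \<in> S \<and> (\<exists>x\<in>S. p = {x, y} \<and> nbhd G x = {y})" by blast
  from bchoice[OF this] obtain y
    where y: "\<forall>p\<in>E ` S. y p \<in> S \<and> (\<exists>x\<in>S. p = {x, y p} \<and> nbhd G x = {y p})" ..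
  have y_E: "\<exists>x t. E v = {x, t} \<and> nbhd G x = {t} \<and> t \<in> S \<and>
      closed_nbhd G t \<subseteq> (\<Union>p\<in>E ` S. closed_nbhd G (y p))" if "v \<in> S" for v
    using bspec[OF y imageI[OF that]] that by auto
  have "B \<subseteq> (\<Union>p\<in>E ` S. closed_nbhd G (y p) \<inter> B)"
  proof
    fix r assume r: "r \<in> B"
    then have "r \<in> verts G" using B by (auto simp: limited_packing2_def)
    have "r \<in> (\<Union>p\<in>E ` S. closed_nbhd G (y p))"
    proof (cases "r \<in> S")
      case True
      then obtain x t where x: "E r = {x, t}" "nbhd G x = {t}"
        and t: "closed_nbhd G t \<subseteq> (\<Union>p\<in>E ` S. closed_nbhd G (y p))"
        using y_E by blast
      have "t \<rightarrow>\<^bsub>G\<^esub> x" using x(2) graph_symmetric[of x t] by (auto simp: nbhd_def)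
      moreover have "r \<in> E r" by (simp add: E_def)
      ultimately have "r \<in> closed_nbhd G t" by (auto simp: x(1) closed_nbhd_def nbhd_def)
      then show ?thesis using t by blast
    next
      case False
      have "m r \<in> nbhd G r \<inter> S" using m \<open>r \<in> verts G\<close> by blast
      then have s: "m r \<in> S" "r \<in> nbhd G (m r)"
        using graph_symmetric[of r "m r"] by (auto simp: nbhd_def)
      from y_E[OF s(1)] obtain x t where x: "E (m r) = {x, t}" "nbhd G x = {t}"
        and t: "closed_nbhd G t \<subseteq> (\<Union>p\<in>E ` S. closed_nbhd G (y p))" "t \<in> S"
        by blast
      have "m r \<in> E (m r)" by (simp add: E_def)
      \<comment> \<open>The only neighbour of the leaf \<open>x\<close> is \<open>t\<close>, which
        lies in \<open>S\<close>, whereas \<open>r\<close> does not; hence \<open>r\<close> hangs on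
        the chosen end \<open>t\<close>.\<close>
      moreover have "m r \<noteq> x" using x(2) t(2) s(2) False by auto
      ultimately have "m r = t" by (simp add: x(1))
      then have "r \<in> closed_nbhd G t" using s(2) by (simp add: closed_nbhd_def)
      then show ?thesis using t(1) by blast
    qed
    then show "r \<in> (\<Union>p\<in>E ` S. closed_nbhd G (y p) \<inter> B)" using r by blast
  qed
  then have "card B \<le> card (\<Union>p\<in>E ` S. closed_nbhd G (y p) \<inter> B)"
    using \<open>finite S\<close> finite_nbhd[OF graph_axioms] by (intro card_mono) (auto simp: closed_nbhd_def)
  also have "\<dots> \<le> (\<Sum>p\<in>E ` S. card (closed_nbhd G (y p) \<inter> B))"
    using \<open>finite S\<close> by (intro card_UN_le) auto
  also have "\<dots> \<le> (\<Sum>p\<in>E ` S. 2)"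
    using y S(1) B by (intro sum_mono) (auto simp: limited_packing2_def)
  also have "\<dots> = 2 * card (E ` S)" by simp
  \<comment> \<open>The matching edges partition \<open>S\<close> into pairs.\<close>
  also have "\<dots> = card (\<Union> (E ` S))"
  proof (rule card_partition)
    show "card c = 2" if "c \<in> E ` S" for c
      using that m'(3) by (auto simp: E_def card_2_iff)
    show "c1 \<inter> c2 = {}" if "c1 \<in> E ` S" "c2 \<in> E ` S" "c1 \<noteq> c2" for c1 c2
    proof -
      have "E w = E v" if "v \<in> S" "w \<in> E v" for v w
        using that E_m[OF that(1)] by (auto simp: E_def)
      then show ?thesis using that by blast
    qed
  qed (use \<open>finite S\<close> in \<open>auto simp: E_def\<close>)
  also have "\<Union> (E ` S) = S" using m'(1) by (auto simp: E_def)
  finally show ?thesis .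
qed

section \<open>Enlarging a packing by insertion and exchange\<close>

text \<open>A closed neighbourhood of \<open>u\<close> could become too full only by containing
  \<open>u\<close> itself, the new \<open>w\<close> and an \<open>S\<close>-neighbour of
  \<open>u\<close>, with \<open>u\<close> in \<open>S\<close>; then \<open>u\<close> is an
  \<open>S\<close>-neighbour of \<open>w\<close>, which \<open>isolated\<close> forbids from having
  an \<open>S\<close>-neighbour.\<close>

lemma (in graph) limited_packing2_insert:
  assumes S: "open_packing G S" and w: "w \<in> verts G"
    and isolated: "\<And>u. u \<in> nbhd G w \<inter> S \<Longrightarrow> nbhd G u \<inter> S = {}"
  shows "limited_packing2 G (insert w S)"
  unfolding limited_packing2_def
proof (intro conjI ballI)
  fix u assume "u \<in> verts G"
  then have "card (nbhd G u \<inter> S) \<le> 1" using S by (simp add: open_packing_def)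
  then obtain q where q: "nbhd G u \<inter> S \<subseteq> {q}"
    using card_le_1D[of "nbhd G u \<inter> S"] finite_nbhd[OF graph_axioms] by auto
  show "card (closed_nbhd G u \<inter> insert w S) \<le> 2"
  proof (cases "u \<in> S \<and> u \<noteq> w")
    case True
    show ?thesis
    proof (cases "w \<in> nbhd G u")
      case adj: True
      then have "nbhd G u \<inter> S = {}" using True isolated by (auto simp: nbhd_def graph_symmetric)
      then show ?thesis by (intro card_le_2I[of _ u w]) (auto simp: closed_nbhd_def)
    next
      case False
      then show ?thesis using q True by (intro card_le_2I[of _ u q]) (auto simp: closed_nbhd_def)
    qed
  next
    case False
    then show ?thesis using q by (intro card_le_2I[of _ w q]) (auto simp: closed_nbhd_def)
  qed
qed (use S w in \<open>auto simp: open_packing_def\<close>)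

text \<open>If \<open>v\<close> had no \<open>S\<close>-neighbour, maximality would force
  \<open>v\<close> into \<open>S\<close>, as it could be inserted otherwise. A neighbour
  \<open>w\<close> of \<open>v\<close> then lies outside \<open>S\<close> and has only
  \<open>v\<close> as \<open>S\<close>-neighbour, so \<open>w\<close> could be inserted
  instead.\<close>

lemma maximum_open_packing_perfect:
  assumes T: "nontrivial_tree G" and S: "open_packing G S"
    and max: "\<And>B. limited_packing2 G B \<Longrightarrow> card B \<le> card S"
    and v: "v \<in> verts G"
  shows "card (nbhd G v \<inter> S) = 1"
proof -
  interpret graph G using T by (rule nontrivial_tree_graph)
  have fin: "finite S" using S finite_subset[OF _ finite_verts] by (auto simp: open_packing_def)
  have no_ext: "\<not> limited_packing2 G (insert w S)" if "w \<notin> S" for w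
    using max[of "insert w S"] that fin by auto
  have "nbhd G v \<inter> S \<noteq> {}"
  proof
    assume empty: "nbhd G v \<inter> S = {}"
    then have "v \<in> S" using limited_packing2_insert[OF S v] no_ext by auto
    obtain w where w: "w \<in> nbhd G v" using nontrivial_tree_nbhd_nonempty[OF T v] by auto
    then have "w \<notin> S" "w \<in> verts G" "v \<in> nbhd G w \<inter> S"
      using empty \<open>v \<in> S\<close> by (auto simp: nbhd_def adj_in_verts graph_symmetric)
    moreover have "card (nbhd G w \<inter> S) \<le> 1" using S \<open>w \<in> verts G\<close> by (simp add: open_packing_def)
    moreover from this obtain q where "nbhd G w \<inter> S \<subseteq> {q}"
      using card_le_1D[of "nbhd G w \<inter> S"] finite_nbhd[OF graph_axioms] by auto
    ultimately have "nbhd G w \<inter> S = {v}" by blast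
    then show False using limited_packing2_insert[OF S \<open>w \<in> verts G\<close>] no_ext[OF \<open>w \<notin> S\<close>] empty by auto
  qed
  then have "card (nbhd G v \<inter> S) \<noteq> 0" using finite_nbhd[OF graph_axioms] by simp
  moreover have "card (nbhd G v \<inter> S) \<le> 1" using S v by (simp add: open_packing_def)
  ultimately show ?thesis by linarith
qed

text \<open>If both ends of a matching edge \<open>x y\<close> had outer neighbours \<open>u\<close> and \<open>v\<close>, replacing \<open>y\<close> by
  \<open>u\<close> and \<open>v\<close> would enlarge the packing; the absence of cycles of length 3, 4 and 5 keeps
  \<open>u\<close> and \<open>v\<close> out of a common closed neighbourhood.\<close>

lemma maximum_open_packing_leaf:
  assumes T: "nontrivial_tree G" and S: "open_packing G S"
    and max: "\<And>B. limited_packing2 G B \<Longrightarrow> card B \<le> card S"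
    and xy: "x \<in> S" "y \<in> S" "x \<rightarrow>\<^bsub>G\<^esub> y"
  shows "degree G x = 1 \<or> degree G y = 1"
proof (rule ccontr)
  assume deg: "\<not> ?thesis"
  interpret graph G using T by (rule nontrivial_tree_graph)
  have SV: "S \<subseteq> verts G" using S by (simp add: open_packing_def)
  have fin: "finite S" using SV finite_verts by (rule finite_subset)
  have "\<forall>v\<in>verts G. card (nbhd G v \<inter> S) = 1"
    using maximum_open_packing_perfect[OF T S max] by blast
  then obtain m where m: "\<forall>v\<in>verts G. nbhd G v \<inter> S = {m v}"
    by (rule obtain_partner)
  have yx: "y \<rightarrow>\<^bsub>G\<^esub> x" using xy(3) by (rule graph_symmetric)
  have xy_neq: "x \<noteq> y" using xy(3) adj_not_same by blast
  have V: "x \<in> verts G" "y \<in> verts G" using xy SV by auto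
  have sole: "a = b" if "w \<rightarrow>\<^bsub>G\<^esub> a" "w \<rightarrow>\<^bsub>G\<^esub> b" "a \<in> S" "b \<in> S" for w a b
  proof -
    have "a \<in> nbhd G w \<inter> S" "b \<in> nbhd G w \<inter> S" using that by (auto simp: nbhd_def)
    then show ?thesis using m adj_in_verts(1)[OF that(1)] by auto
  qed
  have "nbhd G x \<noteq> {y}" "nbhd G y \<noteq> {x}" using deg by (auto simp: degree_def)
  moreover have "y \<in> nbhd G x" "x \<in> nbhd G y" using xy(3) yx by (auto simp: nbhd_def)
  ultimately obtain u v where u: "x \<rightarrow>\<^bsub>G\<^esub> u" "u \<noteq> y" and v: "y \<rightarrow>\<^bsub>G\<^esub> v" "v \<noteq> x"
    by (auto simp: nbhd_def)
  note sym = graph_symmetric[OF u(1)] graph_symmetric[OF v(1)]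
  have uS: "u \<notin> S" using sole[OF u(1) xy(3) _ xy(2)] u(2) by blast
  have vS: "v \<notin> S" using sole[OF v(1) yx _ xy(1)] v(2) by blast
  have uvV: "u \<in> verts G" "v \<in> verts G" using u(1) v(1) by (auto simp: adj_in_verts)
  have "u \<noteq> v"
  proof
    assume "u = v"
    then show False using nontrivial_tree_no_cycle[OF T, of "[u, x, y]"] u v sym xy V uvV uS vS
      xy_neq by (auto simp: vwalk_def)
  qed
  have "\<not> v \<rightarrow>\<^bsub>G\<^esub> u"
    using nontrivial_tree_no_cycle[OF T, of "[u, x, y, v]"] u v sym xy V uvV uS vS \<open>u \<noteq> v\<close>
      xy_neq by (auto simp: vwalk_def)
  then have uv: "\<not> v \<rightarrow>\<^bsub>G\<^esub> u" "\<not> u \<rightarrow>\<^bsub>G\<^esub> v" using graph_symmetric by blast+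
  have no_common: "\<not> w \<rightarrow>\<^bsub>G\<^esub> u" if "w \<rightarrow>\<^bsub>G\<^esub> v" "w \<noteq> x" "w \<noteq> y" for w
  proof
    assume wu: "w \<rightarrow>\<^bsub>G\<^esub> u"
    have "vwalk [u, x, y, v, w] G"
      using xy(3) v(1) sym(1) graph_symmetric[OF that(1)] V uvV adj_in_verts(1)[OF wu]
      by (auto simp: vwalk_def)
    moreover have "distinct [u, x, y, v, w]"
      using that \<open>u \<noteq> v\<close> u v uS vS xy(1,2) wu xy_neq adj_not_same by auto
    ultimately show False using nontrivial_tree_no_cycle[OF T, of "[u, x, y, v, w]"] wu by simp
  qed
  \<comment> \<open>Otherwise \<open>v\<close> would have both \<open>x\<close> and \<open>y\<close>
    as neighbours in \<open>S\<close>; symmetrically for \<open>u\<close> below.\<close>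
  have no_xv: "\<not> x \<rightarrow>\<^bsub>G\<^esub> v"
    using sole[OF sym(2) _ xy(2,1)] graph_symmetric xy_neq by blast
  have no_yu: "\<not> y \<rightarrow>\<^bsub>G\<^esub> u"
    using sole[OF sym(1) _ xy(1,2)] graph_symmetric xy_neq by blast
  define S' where "S' = insert u (insert v (S - {y}))"
  have "limited_packing2 G S'"
    unfolding limited_packing2_def
  proof (intro conjI ballI)
    show "S' \<subseteq> verts G" using SV uvV by (auto simp: S'_def)
    fix w assume w: "w \<in> verts G"
    have mw: "a = m w" if "w \<rightarrow>\<^bsub>G\<^esub> a" "a \<in> S" for a
      using m w that by (auto simp: nbhd_def set_eq_iff)
    \<comment> \<open>The pairs given to \<open>card_le_2I\<close> list what can remain around
      \<open>w\<close>. At \<open>y\<close> and \<open>v\<close> the removal of \<open>y\<close>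
      makes room. Any other vertex of \<open>S\<close> misses both \<open>u\<close> and
      \<open>v\<close>, whose only \<open>S\<close>-neighbours are \<open>x\<close> and
      \<open>y\<close>. A remaining vertex outside \<open>S\<close> sees at most one of
      \<open>u\<close> and \<open>v\<close>, besides its partner \<open>m w\<close>.\<close>
    consider "w = x" | "w = y" | "w = u" | "w = v" | "w \<notin> {x, y, u, v}" "w \<in> S" | "w \<notin> {x, y, u, v}" "w \<notin> S"
      by blast
    then show "card (closed_nbhd G w \<inter> S') \<le> 2"
    proof cases
      case 1
      then have "m w = y" using mw xy by simp
      then show ?thesis using 1 no_xv mw u v uS vS xy(1,2)
        by (intro card_le_2I[of _ x u]) (auto simp: closed_nbhd_def nbhd_def S'_def)
    next
      case 2
      then have "m w = x" using mw xy yx by simp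
      then show ?thesis using 2 no_yu mw u v uS vS xy(1,2)
        by (intro card_le_2I[of _ x v]) (auto simp: closed_nbhd_def nbhd_def S'_def)
    next
      case 3
      then have "m w = x" using mw xy sym by simp
      then show ?thesis using 3 uv mw u v uS vS xy(1,2)
        by (intro card_le_2I[of _ u x]) (auto simp: closed_nbhd_def nbhd_def S'_def)
    next
      case 4
      then have "m w = y" using mw xy sym by simp
      then show ?thesis using 4 uv mw u v uS vS xy(1,2)
        by (intro card_le_2I[of _ v v]) (auto simp: closed_nbhd_def nbhd_def S'_def)
    next
      case 5
      have "\<not> w \<rightarrow>\<^bsub>G\<^esub> u" using sole[OF _ sym(1) _ xy(1), of w] graph_symmetric[of w u] 5 by blast
      moreover have "\<not> w \<rightarrow>\<^bsub>G\<^esub> v" using sole[OF _ sym(2) _ xy(2), of w] graph_symmetric[of w v] 5 by blast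
      ultimately show ?thesis using 5 mw
        by (intro card_le_2I[of _ w "m w"]) (auto simp: closed_nbhd_def nbhd_def S'_def)
    next
      case 6
      show ?thesis
      proof (cases "w \<rightarrow>\<^bsub>G\<^esub> v")
        case True
        then show ?thesis using 6 mw no_common
          by (intro card_le_2I[of _ v "m w"]) (auto simp: closed_nbhd_def nbhd_def S'_def)
      next
        case False
        then show ?thesis using 6 mw
          by (intro card_le_2I[of _ u "m w"]) (auto simp: closed_nbhd_def nbhd_def S'_def)
      qed
    qed
  qed
  moreover have "card S' = Suc (card S)"
    using uS vS \<open>u \<noteq> v\<close> xy(2) fin card_gt_0_iff[of S] by (auto simp: S'_def)
  ultimately show False using max by fastforce
qed

section \<open>The characterisation of equality\<close>

text \<open>Conditions (i) and (ii) together give every vertex exactly one neighbour in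
  \<open>S\<close>, so \<open>S\<close> is an open packing, and by the leaf condition no 2-limited
  packing is larger.\<close>

lemma family_T_imp_L2_le:
  assumes "T \<in> family_T"
  shows "L2 T \<le> open_packing_number T"
proof -
  have tree: "nontrivial_tree T" using assms by (simp add: family_T_def)
  then interpret graph T by (rule nontrivial_tree_graph)
  obtain S R a where part: "S \<union> R = verts T" "S \<inter> R = {}"
    and iso: "digraph_iso (T \<restriction> S) (with_proj (copies_K2 a))"
    and leaf: "\<And>H. subgraph H (T \<restriction> S) \<Longrightarrow> K\<^bsub>2\<^esub> H \<Longrightarrow> \<exists>v\<in>verts H. degree T v = 1"
    and R: "\<forall>r\<in>R. card (nbhd T r \<inter> S) = 1"
    using assms unfolding family_T_def by blast
  have perfect: "\<forall>v\<in>verts T. card (nbhd T v \<inter> S) = 1"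
    using induced_copies_K2_nbhd[OF iso] R part by blast
  have "degree T x = 1 \<or> degree T y = 1" if xy: "x \<in> S" "y \<in> S" "x \<rightarrow>\<^bsub>T\<^esub> y" for x y
  proof -
    \<comment> \<open>The edge \<open>x y\<close> induces a complete graph on two vertices, a copy
      of $K_2$ to which the leaf condition applies.\<close>
    let ?H = "T \<restriction> {x, y}"
    have "{x, y} \<subseteq> verts T" using xy part by blast
    then have ind: "induced_subgraph ?H T" by (rule induced_induce)
    then interpret H: digraph ?H by (rule digraphI_induced)
    have "graph ?H" using induced_graph_imp_symmetric[OF sym_arcs ind] by (rule H.graphI)
    moreover have "subgraph ?H (T \<restriction> S)"
      using xy wellformed_induce_subgraph by (auto simp: subgraph_def compatible_def)
    moreover have "x \<noteq> y" using xy(3) adj_not_same by blast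
    then have "card (verts ?H) = 2" by simp
    moreover have "arcs_ends ?H = {(a, b). (a, b) \<in> verts ?H \<times> verts ?H \<and> a \<noteq> b}"
      using xy(3) graph_symmetric[OF xy(3)] by (auto simp: arcs_ends_conv dest: no_loops)
    ultimately have "\<exists>v\<in>verts ?H. degree T v = 1"
      by (intro leaf) (auto simp: complete_digraph_def)
    then show ?thesis by auto
  qed
  then have "card B \<le> card S" if "limited_packing2 T B" for B
    using limited_packing2_card_le_perfect[OF _ perfect _ that] part by blast
  moreover have "open_packing T S" using perfect part by (auto simp: open_packing_def)
  ultimately show ?thesis
    by (metis L2_attained graph_axioms open_packing_number_ge order_trans)
qed

lemma eq_imp_family_T:
  assumes T: "nontrivial_tree T" and eq: "open_packing_number T = L2 T"
  shows "T \<in> family_T"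
proof -
  interpret graph T using T by (rule nontrivial_tree_graph)
  obtain S where S: "open_packing T S" "card S = open_packing_number T"
    using open_packing_number_attained graph_axioms by blast
  have max: "card B \<le> card S" if "limited_packing2 T B" for B
    using L2_ge[OF graph_axioms that] eq S(2) by simp
  note perfect = maximum_open_packing_perfect[OF T S(1) max]
  note leaf = maximum_open_packing_leaf[OF T S(1) max]
  have SV: "S \<subseteq> verts T" using S(1) by (simp add: open_packing_def)
  obtain w where "w \<in> verts T" using T by (force simp: nontrivial_tree_def)
  \<comment> \<open>Some vertex exists and has a neighbour in \<open>S\<close>; this yields the
    positivity of \<open>a\<close>.\<close>
  then have "S \<noteq> {}" using perfect[of w] by auto
  then have "\<exists>a>0. digraph_iso (T \<restriction> S) (with_proj (copies_K2 a))"
    using induced_copies_K2I[OF SV] perfect SV by blast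
  moreover have "\<exists>v\<in>verts H. degree T v = 1" if H: "subgraph H (T \<restriction> S)" "K\<^bsub>2\<^esub> H" for H
  proof -
    obtain x y where xy: "verts H = {x, y}" "x \<noteq> y"
      using H(2) by (auto simp: complete_digraph_def card_2_iff)
    have "x \<rightarrow>\<^bsub>H\<^esub> y" using H(2) xy by (auto simp: complete_digraph_def)
    then have "x \<rightarrow>\<^bsub>T \<restriction> S\<^esub> y" using pre_digraph.adj_mono[OF _ H(1)] by blast
    then have "x \<in> S" "y \<in> S" "x \<rightarrow>\<^bsub>T\<^esub> y" by (auto simp: arcs_ends_conv)
    then show ?thesis using leaf xy(1) by blast
  qed
  ultimately show ?thesis
    unfolding family_T_def using T SV perfect
    by (intro CollectI conjI exI[of _ S] exI[of _ "verts T - S"]) auto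
qed

theorem theorem5p4:
  fixes T :: "('a, 'b) pre_digraph"
  assumes "nontrivial_tree T"
  shows "open_packing_number T \<le> L2 T \<and> L2 T \<le> 2 * open_packing_number T \<and>
    (open_packing_number T = L2 T \<longleftrightarrow> T \<in> family_T)"
proof -
  have graph: "graph T" using assms by (rule nontrivial_tree_graph)
  have le: "open_packing_number T \<le> L2 T"
    by (metis open_packing_number_attained L2_ge graph open_packing_imp_limited_packing2)
  moreover have "L2 T \<le> 2 * open_packing_number T"
  proof -
    obtain B where B: "limited_packing2 T B" "card B = L2 T" using L2_attained graph by blast
    obtain S where "open_packing T S" "card B \<le> 2 * card S"
      using limited_packing2_card_le[OF assms B(1)] by blast
    then show ?thesis using open_packing_number_ge[OF graph, of S] B(2) by linarith
  qed
  ultimately show ?thesis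
    using family_T_imp_L2_le[of T] eq_imp_family_T[OF assms] by auto
qed

end
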